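(* For every positive integer $n$, $$\sum_{k=1}^{\infty}\frac{\zeta(2k+1)}{(2k+1)\,4^k\,F_{2n}^{2k}}=F_{2n}\left(\ln\Gamma\left(\frac{2L_nF_n-1}{2L_nF_n}\right)-\ln\Gamma\left(\frac{2L_nF_n+1}{2L_nF_n}\right)\right)-\gamma.$$
   Context: $\zeta$ denotes the Riemann zeta function, $\Gamma$ the gamma function, and $\gamma$ the Euler-Mascheroni constant. $F_n$ and $L_n$ denote the Fibonacci and Lucas numbers: both satisfy $x_n=x_{n-1}+x_{n-2}$ for $n\ge 2$, with $F_0=0$, $F_1=1$ and $L_0=2$, $L_1=1$. *)

theory Defs
  imports
    "HOL-Analysis.Analysis"
    "HOL-Number_Theory.Fib"
begin

text \<open>
  The Riemann zeta function at real arguments \<open>s > 1\<close>, given by its Dirichlet series, whose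
  terms start at index 1. For \<open>s \<le> 1\<close> the series diverges and the value is meaningless.
\<close>

definition zeta :: "real \<Rightarrow> real" where
  "zeta s = (\<Sum>m. 1 / real (Suc m) powr s)"

fun lucas :: "nat \<Rightarrow> nat" where
  "lucas 0 = 2"
| "lucas (Suc 0) = 1"
| "lucas (Suc (Suc n)) = lucas (Suc n) + lucas n"

end

theory Submission
  imports Defs
begin

text \<open>
  Put \<open>x = 1 / (2 F\<^bsub>2n\<^esub>)\<close>. Since \<open>F\<^bsub>2n\<^esub> = L\<^sub>n F\<^sub>n\<close>, the two Gamma arguments are \<open>1 - x\<close> and
  \<open>1 + x\<close>, and the factor \<open>1 / (4\<^sup>k F\<^bsub>2n\<^esub>\<^bsup>2k\<^esup>)\<close> is \<open>x\<^bsup>2k\<^esup>\<close>. The claim is therefore the expansion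
  \<open>ln \<Gamma>(1 - x) - ln \<Gamma>(1 + x) - 2 \<gamma> x = \<Sum>\<^bsub>k \<ge> 1\<^esub> 2 \<zeta>(2k+1) x\<^bsup>2k+1\<^esup> / (2k+1)\<close>
  at this \<open>x\<close>, which lies in \<open>(0, 1)\<close>, divided by \<open>2 x\<close>; see \<open>zeta_odd_sums_ln_Gamma\<close>.

  The expansion comes from one double series with nonnegative terms, \<open>2 (x/m)\<^bsup>2k+1\<^esup> / (2k+1)\<close> with
  \<open>m, k \<ge> 1\<close>, summed in both orders. Summing over \<open>m\<close> first produces the zeta values. Summing over
  \<open>k\<close> first produces \<open>ln (1 + x/m) - ln (1 - x/m) - 2 x/m\<close>, twice the odd part of \<open>ln (1 + x/m)\<close>
  without its linear term, and the sum of these over \<open>m\<close> is the left-hand side by Euler's limit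
  formula for \<open>ln \<Gamma>\<close> (\<open>ln_Gamma_reflected_diff_sums\<close>).
\<close>

text \<open>
  The linear term is split off because it is the one whose sum over \<open>t = x/m\<close> diverges. The series
  itself is the expansion of \<open>ln w\<close> in powers of \<open>(w - 1) / (w + 1)\<close> at \<open>w = (1 + t) / (1 - t)\<close>.
\<close>

lemma ln_quotient_minus_linear_sums:
  fixes t :: real
  assumes "\<bar>t\<bar> < 1"
  shows "(\<lambda>j. 2 * t ^ (2 * j + 3) / real (2 * j + 3)) sums (ln (1 + t) - ln (1 - t) - 2 * t)"
proof -
  have t: "1 + t > 0" "1 - t > 0" using assms by auto
  define w where "w = (1 + t) / (1 - t)"
  have "w > 0" using t by (simp add: w_def)
  have "w - 1 = 2 * t / (1 - t)" "w + 1 = 2 / (1 - t)"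
    using t by (simp_all add: w_def field_simps)
  hence w: "(w - 1) / (w + 1) = t" using t by simp
  have "ln w = ln (1 + t) - ln (1 - t)"
    using t by (simp add: w_def ln_div)
  with ln_series_quadratic[OF \<open>w > 0\<close>]
  have "(\<lambda>j. 2 * t ^ (2 * j + 1) / real (2 * j + 1)) sums (ln (1 + t) - ln (1 - t))"
    unfolding w by simp
  from sums_split_initial_segment[OF this, of 1] show ?thesis
    by (simp add: algebra_simps power_add eval_nat_numeral)
qed

text \<open>
  In Euler's formula \<open>ln \<Gamma>(z) = lim (z ln n - ln z - \<Sum>\<^bsub>k \<le> n\<^esub> ln (1 + z/k))\<close>, the shift by 1 in
  \<open>z = 1 \<plusminus> x\<close> turns the factors \<open>(k + z) / k\<close> into \<open>(k + 1 \<plusminus> x) / k\<close>, so in the difference the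
  denominators cancel and the isolated term \<open>ln z\<close> supplies the missing factor \<open>1 \<plusminus> x\<close>. Removing
  \<open>2 x/m\<close> from each term changes the divergent \<open>2 x ln n\<close> into \<open>2 x (ln n - H\<^sub>n)\<close>, which is where
  the Euler-Mascheroni constant enters.
\<close>

lemma ln_Gamma_reflected_diff_sums:
  fixes x :: real
  assumes "\<bar>x\<bar> < 1"
  shows "(\<lambda>m. ln (1 + x / real (Suc m)) - ln (1 - x / real (Suc m)) - 2 * (x / real (Suc m)))
           sums (ln_Gamma (1 - x) - ln_Gamma (1 + x) - 2 * x * euler_mascheroni)"
proof -
  define f where "f m = ln (real (Suc m) + x) - ln (real (Suc m) - x)" for m
  have f: "ln (1 + x / real (Suc m)) - ln (1 - x / real (Suc m)) = f m" for m
  proof -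
    have "real (Suc m) + x > 0" "real (Suc m) - x > 0" using assms by auto
    moreover have "1 + x / real (Suc m) = (real (Suc m) + x) / real (Suc m)"
      "1 - x / real (Suc m) = (real (Suc m) - x) / real (Suc m)"
      by (simp_all add: field_simps)
    ultimately show ?thesis by (simp add: f_def ln_div del: of_nat_Suc)
  qed
  have series: "ln_Gamma_series (1 - x) n - ln_Gamma_series (1 + x) n
      = sum f {..<Suc n} - 2 * x * ln (real n)" for n
  proof -
    have shifted: "ln ((1 + x) / real (Suc m) + 1) - ln ((1 - x) / real (Suc m) + 1) = f (Suc m)" for m
    proof -
      have "real (Suc (Suc m)) + x > 0" "real (Suc (Suc m)) - x > 0" using assms by auto
      moreover have "(1 + x) / real (Suc m) + 1 = (real (Suc (Suc m)) + x) / real (Suc m)"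
        "(1 - x) / real (Suc m) + 1 = (real (Suc (Suc m)) - x) / real (Suc m)"
        by (simp_all add: field_simps)
      ultimately show ?thesis by (simp add: f_def ln_div del: of_nat_Suc)
    qed
    have "(\<Sum>k=1..n. ln ((1 + x) / real k + 1)) - (\<Sum>k=1..n. ln ((1 - x) / real k + 1))
        = (\<Sum>m<n. f (Suc m))"
      unfolding sum_subtractf[symmetric] One_nat_def sum.atLeast1_atMost_eq
      by (simp only: shifted)
    moreover have "sum f {..<Suc n} = ln (1 + x) - ln (1 - x) + (\<Sum>m<n. f (Suc m))"
      by (subst sum.lessThan_Suc_shift) (simp add: f_def)
    ultimately show ?thesis
      by (simp add: ln_Gamma_series_def algebra_simps)
  qed
  have "(\<lambda>n. ln_Gamma_series (1 - x) n - ln_Gamma_series (1 + x) n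
            - 2 * x * (harm n - ln (real n)) - 2 * x * inverse (real (Suc n)))
        \<longlonglongrightarrow> ln_Gamma (1 - x) - ln_Gamma (1 + x) - 2 * x * euler_mascheroni - 2 * x * 0"
    using assms
    by (intro tendsto_intros ln_Gamma_real_LIMSEQ euler_mascheroni_LIMSEQ
              LIMSEQ_inverse_real_of_nat) auto
  also have "(\<lambda>n. ln_Gamma_series (1 - x) n - ln_Gamma_series (1 + x) n
            - 2 * x * (harm n - ln (real n)) - 2 * x * inverse (real (Suc n)))
        = (\<lambda>n. \<Sum>m<Suc n. f m - 2 * (x / real (Suc m)))"
  proof
    fix n
    have "(\<Sum>m<Suc n. 2 * (x / real (Suc m))) = 2 * x * harm (Suc n)"
      unfolding harm_def One_nat_def sum.atLeast1_atMost_eq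
      by (simp only: sum_distrib_left divide_inverse mult.assoc)
    thus "ln_Gamma_series (1 - x) n - ln_Gamma_series (1 + x) n
            - 2 * x * (harm n - ln (real n)) - 2 * x * inverse (real (Suc n))
        = (\<Sum>m<Suc n. f m - 2 * (x / real (Suc m)))"
      by (simp only: series sum_subtractf harm_Suc) (simp only: algebra_simps)
  qed
  finally show ?thesis
    unfolding sums_def f by (subst (asm) filterlim_sequentially_Suc) simp
qed

text \<open>
  Tonelli's theorem for sequences: nonnegative terms with convergent iterated sums are summable over
  all pairs of indices, and an unordered sum does not depend on the order of the coordinates.
\<close>

lemma sums_nonneg_swap:
  fixes f :: "nat \<Rightarrow> nat \<Rightarrow> real"
  assumes nonneg: "\<And>i j. f i j \<ge> 0"
    and rows: "\<And>i. f i sums r i"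
    and total: "r sums S"
    and columns: "\<And>j. (\<lambda>i. f i j) sums c j"
  shows "c sums S"
proof -
  have row: "((\<lambda>j. f i j) has_sum r i) UNIV" for i
    using rows nonneg by (intro sums_nonneg_imp_has_sum)
  have "r i \<ge> 0" for i
    using nonneg by (intro has_sum_nonneg[OF row])
  hence r: "(r has_sum S) UNIV"
    using total by (intro sums_nonneg_imp_has_sum)
  have "(\<lambda>(i, j). f i j) summable_on (UNIV \<times> UNIV)"
    using row r nonneg by (intro summable_on_SigmaI[where g = r]) (auto simp: summable_on_def)
  hence "((\<lambda>(i, j). f i j) has_sum S) (UNIV \<times> UNIV)"
    using row r by (intro has_sum_SigmaI[where g = r]) auto
  hence "((\<lambda>(j, i). f i j) has_sum S) (UNIV \<times> UNIV)"
    by (subst (asm) has_sum_swap) simp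
  moreover have "((\<lambda>i. f i j) has_sum c j) UNIV" for j
    using columns nonneg by (intro sums_nonneg_imp_has_sum)
  ultimately have "(c has_sum S) UNIV"
    using has_sum_SigmaD[where f = "\<lambda>(j, i). f i j" and A = UNIV and B = "\<lambda>_. UNIV" and g = c and S = S]
    by simp
  thus ?thesis by (rule has_sum_imp_sums)
qed

lemma zeta_nat_sums:
  assumes "s \<ge> 2"
  shows "(\<lambda>m. 1 / real (Suc m) ^ s) sums zeta (real s)"
proof -
  have "summable (\<lambda>m. inverse (real m ^ s))"
    using inverse_power_summable[OF assms, where 'a = real] by simp
  hence "summable (\<lambda>m. inverse (real (Suc m) ^ s))"
    by (subst summable_Suc_iff)
  hence "summable (\<lambda>m. 1 / real (Suc m) ^ s)"
    by (simp add: divide_inverse)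
  thus ?thesis
    unfolding zeta_def by (simp add: summable_sums powr_realpow del: of_nat_Suc)
qed

lemma zeta_odd_sums_ln_Gamma:
  fixes x :: real
  assumes "0 \<le> x" "x < 1"
  shows "(\<lambda>j. 2 * x ^ (2 * j + 3) / real (2 * j + 3) * zeta (real (2 * j + 3)))
           sums (ln_Gamma (1 - x) - ln_Gamma (1 + x) - 2 * x * euler_mascheroni)"
proof (rule sums_nonneg_swap)
  show "0 \<le> 2 * (x / real (Suc m)) ^ (2 * j + 3) / real (2 * j + 3)" for m j
    using assms by simp
  have "\<bar>x / real (Suc m)\<bar> < 1" for m
    using assms by (simp add: field_simps)
  thus "(\<lambda>j. 2 * (x / real (Suc m)) ^ (2 * j + 3) / real (2 * j + 3)) sums
      (ln (1 + x / real (Suc m)) - ln (1 - x / real (Suc m)) - 2 * (x / real (Suc m)))" for m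
    by (intro ln_quotient_minus_linear_sums)
  show "(\<lambda>m. ln (1 + x / real (Suc m)) - ln (1 - x / real (Suc m)) - 2 * (x / real (Suc m)))
      sums (ln_Gamma (1 - x) - ln_Gamma (1 + x) - 2 * x * euler_mascheroni)"
    using assms by (intro ln_Gamma_reflected_diff_sums) simp
  fix j
  have "(\<lambda>m. 2 * x ^ (2 * j + 3) / real (2 * j + 3) * (1 / real (Suc m) ^ (2 * j + 3)))
      sums (2 * x ^ (2 * j + 3) / real (2 * j + 3) * zeta (real (2 * j + 3)))"
    by (intro sums_mult zeta_nat_sums) simp
  moreover have "2 * x ^ (2 * j + 3) / real (2 * j + 3) * (1 / real (Suc m) ^ (2 * j + 3))
      = 2 * (x / real (Suc m)) ^ (2 * j + 3) / real (2 * j + 3)" for m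
    by (simp only: power_divide) simp
  ultimately show "(\<lambda>m. 2 * (x / real (Suc m)) ^ (2 * j + 3) / real (2 * j + 3))
      sums (2 * x ^ (2 * j + 3) / real (2 * j + 3) * zeta (real (2 * j + 3)))"
    by simp
qed

lemma lucas_Suc_conv_fib: "lucas (Suc n) = fib n + fib (Suc (Suc n))"
  by (induction n rule: fib.induct) simp_all

lemma fib_double: "fib (2 * n) = lucas n * fib n"
proof (cases n)
  case (Suc m)
  thus ?thesis using fib_rec_even[of n] by (simp add: lucas_Suc_conv_fib)
qed simp

theorem theorem3p2p3:
  fixes n :: nat
  assumes "n > 0"
  shows "(\<lambda>j. let k = Suc j in
            zeta (real (2 * k + 1)) / (real (2 * k + 1) * 4 ^ k * real (fib (2 * n)) ^ (2 * k)))
         sums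
         (real (fib (2 * n)) *
            (ln (Gamma ((2 * real (lucas n) * real (fib n) - 1) / (2 * real (lucas n) * real (fib n))))
             - ln (Gamma ((2 * real (lucas n) * real (fib n) + 1) / (2 * real (lucas n) * real (fib n)))))
          - euler_mascheroni)"
proof -
  define F where "F = real (fib (2 * n))"
  define x where "x = 1 / (2 * F)"
  have "fib (2 * n) > 0" using assms by (intro fib_neq_0_nat) simp
  hence F: "F \<ge> 1" by (simp add: F_def)
  hence x: "0 < x" "x < 1" by (auto simp: x_def field_simps)
  have LF: "2 * real (lucas n) * real (fib n) = 2 * F"
    by (simp add: F_def fib_double)
  have args: "(2 * F - 1) / (2 * F) = 1 - x" "(2 * F + 1) / (2 * F) = 1 + x"
    using F by (simp_all add: x_def field_simps)
  have "(\<lambda>j. F * (2 * x ^ (2 * j + 3) / real (2 * j + 3) * zeta (real (2 * j + 3))))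
      sums (F * (ln_Gamma (1 - x) - ln_Gamma (1 + x) - 2 * x * euler_mascheroni))"
    using x by (intro sums_mult zeta_odd_sums_ln_Gamma) auto
  moreover have "F * (ln_Gamma (1 - x) - ln_Gamma (1 + x) - 2 * x * euler_mascheroni)
      = F * (ln (Gamma (1 - x)) - ln (Gamma (1 + x))) - euler_mascheroni"
    using F x by (simp add: ln_Gamma_real_pos right_diff_distrib) (simp add: x_def)
  moreover have "F * (2 * x ^ (2 * j + 3) / real (2 * j + 3) * zeta (real (2 * j + 3)))
      = zeta (real (2 * Suc j + 1)) / (real (2 * Suc j + 1) * 4 ^ Suc j * F ^ (2 * Suc j))" for j
  proof -
    have "x ^ (2 * j + 3) = x * (x\<^sup>2) ^ Suc j"
      by (simp add: power_mult power_add power2_eq_square power3_eq_cube)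
    also have "x\<^sup>2 = 1 / (4 * F\<^sup>2)"
      by (simp add: x_def power_divide power_mult_distrib)
    also have "(1 / (4 * F\<^sup>2)) ^ Suc j = 1 / (4 ^ Suc j * F ^ (2 * Suc j))"
      by (simp only: power_divide power_mult_distrib power_mult power_one)
    finally have pow: "F * (2 * x ^ (2 * j + 3)) = 1 / (4 ^ Suc j * F ^ (2 * Suc j))"
      using F by (simp add: x_def)
    have idx: "2 * j + 3 = 2 * Suc j + 1" by simp
    have "F * (2 * x ^ (2 * j + 3) / real (2 * j + 3) * zeta (real (2 * j + 3)))
        = F * (2 * x ^ (2 * j + 3)) * zeta (real (2 * j + 3)) / real (2 * j + 3)" by simp
    also have "\<dots> = zeta (real (2 * Suc j + 1)) / (real (2 * Suc j + 1) * 4 ^ Suc j * F ^ (2 * Suc j))"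
      unfolding pow unfolding idx by (simp add: mult_ac del: of_nat_Suc of_nat_add power_Suc)
    finally show ?thesis .
  qed
  ultimately show ?thesis
    unfolding Let_def LF args F_def[symmetric] by simp
qed

end
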